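(* Let $\alpha^{(4)}:I\to\mathbb{E}^4$ be a quaternionic curve with arc-length parameter $s$ whose curvature functions $K(s)$ and $k(s)$ are non-constant functions and satisfy $$K(s)=\lambda\left\{K^2(s)+k^2(s)\right\}\quad\text{for all } s\in I,$$ where $\lambda$ is a constant. Suppose the quaternionic curve $\beta^{(4)}$, with arc-length parameter $\overline{s}=\psi(s)$, is given by $\beta^{(4)}(\overline{s})=\alpha^{(4)}(s)+\lambda N(s)$, $s\in I$. Then $\alpha^{(4)}$ is a quaternionic Mannheim curve and $\beta^{(4)}$ is the quaternionic Mannheim partner curve of $\alpha^{(4)}$.
   Context: Let $Q_H$ be the algebra of real quaternions $q=a e_1+b e_2+c e_3+d$, with $e_1^2=e_2^2=e_3^2=-1$, $e_1e_2=e_3=-e_2e_1$, $e_2e_3=e_1=-e_3e_2$, $e_3e_1=e_2=-e_1e_3$. Let $\gamma$ be quaternionic conjugation, $\gamma q=-ae_1-be_2-ce_3+d$, and let $h(p,q)=\frac12(p\times\gamma q+q\times\gamma p)$ (where $\times$ is quaternion multiplication), which is the Euclidean inner product. The space $\mathbb{E}^4$ is identified with $Q_H$. A quaternionic curve is a smooth arc-length parametrized curve $\alpha^{(4)}:I\to\mathbb{E}^4$ on an interval $I\subset\mathbb{R}$ with nowhere-zero curvatures $K$ (principal curvature), $k$ (torsion), $r-K$ (bitorsion) and orthonormal Frenet frame $\{T,N,B_1,B_2\}$ (first to fourth Frenet vectors), $T=(\alpha^{(4)})'$, satisfying $T'=KN$, $N'=-KT+kB_1$, $B_1'=-kN+(r-K)B_2$,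 $B_2'=-(r-K)B_1$. Here $r-K$ is just the notation for the third curvature function. The corresponding objects for a curve $\beta^{(4)}$ with arc-length parameter $\overline{s}\in\overline{I}$ carry bars: $\overline{T},\overline{N},\overline{B}_1,\overline{B}_2$. In particular, calling $\beta^{(4)}$ a quaternionic curve includes that it has such a Frenet frame with nowhere-zero curvatures. A quaternionic curve $\alpha^{(4)}:I\to\mathbb{E}^4$ is a quaternionic Mannheim curve if there exist a quaternionic curve $\beta^{(4)}:\overline{I}\to\mathbb{E}^4$ (called a quaternionic Mannheim partner curve of $\alpha^{(4)}$) and a bijection $\varphi$ from $\alpha^{(4)}$ to $\beta^{(4)}$, $\varphi(\alpha^{(4)}(s))=\beta^{(4)}(\psi(s))$ with $\psi:I\to\overline{I}$ a smooth bijection with nowhere-zero derivative, such that for every $s\in I$ the second Frenet vector $N(s)$ lies in the plane spanned by the third and fourth Frenet vectors $\overline{B}_1(\psi(s))$, $\overline{B}_2(\psi(s))$ of $\beta^{(4)}$ at the corresponding point, and $\beta^{(4)}(\psi(s))=\alpha^{(4)}(s)+\lambda(s)N(s)$ for some smooth real function $\lambda$ on $I$. *)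

theory Defs
  imports "HOL-Analysis.Analysis"
begin

text \<open>
  The algebra of real quaternions on Euclidean 4-space. The coordinates 1, 2, 3 are the
  coefficients of \<open>e\<^sub>1, e\<^sub>2, e\<^sub>3\<close> and the coordinate 4 is the scalar part, so that
  \<open>a e\<^sub>1 + b e\<^sub>2 + c e\<^sub>3 + d\<close> is \<open>vector [a, b, c, d]\<close>.
\<close>

type_synonym quat = "real^4"

definition qmult :: "quat \<Rightarrow> quat \<Rightarrow> quat" (infixl \<open>\<otimes>\<^sub>Q\<close> 70) where
  "p \<otimes>\<^sub>Q q = vector
     [p$1 * q$4 + p$4 * q$1 + p$2 * q$3 - p$3 * q$2,
      p$2 * q$4 + p$4 * q$2 + p$3 * q$1 - p$1 * q$3,
      p$3 * q$4 + p$4 * q$3 + p$1 * q$2 - p$2 * q$1,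
      p$4 * q$4 - p$1 * q$1 - p$2 * q$2 - p$3 * q$3]"

definition qconj :: "quat \<Rightarrow> quat" where
  "qconj q = vector [- q$1, - q$2, - q$3, q$4]"

definition qform :: "quat \<Rightarrow> quat \<Rightarrow> quat" where
  "qform p q = (1/2) *\<^sub>R (p \<otimes>\<^sub>Q qconj q + q \<otimes>\<^sub>Q qconj p)"

text \<open>The quaternion \<open>qform p q\<close> is scalar (lemma \<open>qform_scalar\<close>); \<open>h p q\<close> is its real value.\<close>

definition h :: "quat \<Rightarrow> quat \<Rightarrow> real" where
  "h p q = qform p q $ 4"

lemma vector_4 [simp]:
  "(vector [a, b, c, d] :: 'a::zero^4) $ 1 = a"
  "(vector [a, b, c, d] :: 'a::zero^4) $ 2 = b"
  "(vector [a, b, c, d] :: 'a::zero^4) $ 3 = c"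
  "(vector [a, b, c, d] :: 'a::zero^4) $ 4 = d"
  unfolding vector_def by auto

lemma quat_eq_iff: "p = q \<longleftrightarrow> p$1 = q$1 \<and> p$2 = q$2 \<and> p$3 = q$3 \<and> p$4 = q$4" for p q :: quat
  by (simp add: vec_eq_iff forall_4)

lemma quaternion_relations:
  fixes e1 e2 e3 one :: quat
  defines "e1 \<equiv> vector [1, 0, 0, 0]" and "e2 \<equiv> vector [0, 1, 0, 0]"
    and "e3 \<equiv> vector [0, 0, 1, 0]" and "one \<equiv> vector [0, 0, 0, 1]"
  shows "one \<otimes>\<^sub>Q q = q" "q \<otimes>\<^sub>Q one = q"
    and "e1 \<otimes>\<^sub>Q e1 = - one" "e2 \<otimes>\<^sub>Q e2 = - one" "e3 \<otimes>\<^sub>Q e3 = - one"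
    and "e1 \<otimes>\<^sub>Q e2 = e3" "e2 \<otimes>\<^sub>Q e1 = - e3"
    and "e2 \<otimes>\<^sub>Q e3 = e1" "e3 \<otimes>\<^sub>Q e2 = - e1"
    and "e3 \<otimes>\<^sub>Q e1 = e2" "e1 \<otimes>\<^sub>Q e3 = - e2"
  by (simp_all add: assms qmult_def quat_eq_iff)

lemma h_eq_inner: "h p q = p \<bullet> q"
  by (simp add: h_def qform_def qmult_def qconj_def inner_vec_def sum_4 algebra_simps)

lemma qform_scalar: "qform p q = h p q *\<^sub>R vector [0, 0, 0, 1]"
  by (simp add: h_def qform_def qmult_def qconj_def quat_eq_iff algebra_simps)

text \<open>
  Smoothness on a non-degenerate interval \<open>I\<close> (open or not): derivatives are taken within \<open>I\<close>,
  so they are one-sided at end points belonging to \<open>I\<close>. \<open>D n\<close> is the \<open>n\<close>-th derivative.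
\<close>

definition smooth_on :: "real set \<Rightarrow> (real \<Rightarrow> 'a::real_normed_vector) \<Rightarrow> bool" where
  "smooth_on I f \<longleftrightarrow> (\<exists>D :: nat \<Rightarrow> real \<Rightarrow> 'a.
     (\<forall>s\<in>I. D 0 s = f s) \<and>
     (\<forall>n. \<forall>s\<in>I. (D n has_vector_derivative D (Suc n) s) (at s within I)))"

definition nondegenerate_interval :: "real set \<Rightarrow> bool" where
  "nondegenerate_interval I \<longleftrightarrow> is_interval I \<and> (\<exists>a\<in>I. \<exists>b\<in>I. a < b)"

text \<open>
  A curve together with its Frenet apparatus; \<open>cbit\<close> is the bitorsion, written \<open>r - K\<close> in the
  literature. Only the values at parameters in \<open>cdom\<close> are meaningful.
\<close>

record curve4 =
  cdom :: "real set"
  cpos :: "real \<Rightarrow> quat"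
  cT  :: "real \<Rightarrow> quat"
  cN  :: "real \<Rightarrow> quat"
  cB1 :: "real \<Rightarrow> quat"
  cB2 :: "real \<Rightarrow> quat"
  cK  :: "real \<Rightarrow> real"
  ck  :: "real \<Rightarrow> real"
  cbit :: "real \<Rightarrow> real"

definition h_orthonormal4 :: "quat \<Rightarrow> quat \<Rightarrow> quat \<Rightarrow> quat \<Rightarrow> bool" where
  "h_orthonormal4 t n b c \<longleftrightarrow>
     h t t = 1 \<and> h n n = 1 \<and> h b b = 1 \<and> h c c = 1 \<and>
     h t n = 0 \<and> h t b = 0 \<and> h t c = 0 \<and> h n b = 0 \<and> h n c = 0 \<and> h b c = 0"

text \<open>
  Arc-length parametrization is the conjunction of \<open>T = \<alpha>'\<close> and \<open>h T T = 1\<close>. The curvatures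
  are nowhere zero but not required to be positive. Smoothness of the frame
  and of the curvatures is not listed separately: it follows from the smoothness of the curve,
  the Frenet equations and the nowhere vanishing of the curvatures.
\<close>

definition quaternionic_curve :: "curve4 \<Rightarrow> bool" where
  "quaternionic_curve C \<longleftrightarrow>
     nondegenerate_interval (cdom C) \<and>
     smooth_on (cdom C) (cpos C) \<and>
     (\<forall>s\<in>cdom C.
        cK C s \<noteq> 0 \<and> ck C s \<noteq> 0 \<and> cbit C s \<noteq> 0 \<and>
        h_orthonormal4 (cT C s) (cN C s) (cB1 C s) (cB2 C s) \<and>
        (cpos C has_vector_derivative cT C s) (at s within cdom C) \<and>
        (cT C has_vector_derivative cK C s *\<^sub>R cN C s) (at s within cdom C) \<and>
        (cN C has_vector_derivative - cK C s *\<^sub>R cT C s + ck C s *\<^sub>R cB1 C s)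
          (at s within cdom C) \<and>
        (cB1 C has_vector_derivative - ck C s *\<^sub>R cN C s + cbit C s *\<^sub>R cB2 C s)
          (at s within cdom C) \<and>
        (cB2 C has_vector_derivative - cbit C s *\<^sub>R cB1 C s) (at s within cdom C))"

text \<open>
  A point of a parametrized curve carries its parameter value. Hence a point of \<open>\<real>\<^sup>4\<close> that
  the curve passes through several times counts as several points of the curve, and a
  correspondence between curves need not respect such self-intersections.
\<close>

definition curve_points :: "curve4 \<Rightarrow> (real \<times> quat) set" where
  "curve_points C = (\<lambda>s. (s, cpos C s)) ` cdom C"

definition mannheim_partner :: "curve4 \<Rightarrow> curve4 \<Rightarrow> bool" where
  "mannheim_partner A B \<longleftrightarrow>
     quaternionic_curve A \<and> quaternionic_curve B \<and>
     (\<exists>\<phi> \<psi> lam.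
        bij_betw \<phi> (curve_points A) (curve_points B) \<and>
        (\<forall>s\<in>cdom A. \<phi> (s, cpos A s) = (\<psi> s, cpos B (\<psi> s))) \<and>
        bij_betw \<psi> (cdom A) (cdom B) \<and>
        smooth_on (cdom A) \<psi> \<and>
        (\<forall>s\<in>cdom A. \<exists>d. (\<psi> has_real_derivative d) (at s within cdom A) \<and> d \<noteq> 0) \<and>
        smooth_on (cdom A) (lam :: real \<Rightarrow> real) \<and>
        (\<forall>s\<in>cdom A. cN A s \<in> span {cB1 B (\<psi> s), cB2 B (\<psi> s)}) \<and>
        (\<forall>s\<in>cdom A. cpos B (\<psi> s) = cpos A s + lam s *\<^sub>R cN A s))"

definition quaternionic_mannheim_curve :: "curve4 \<Rightarrow> bool" where
  "quaternionic_mannheim_curve A \<longleftrightarrow> quaternionic_curve A \<and> (\<exists>B. mannheim_partner A B)"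

end

theory Submission
  imports Defs
begin

text \<open>
  Put \<open>f = \<psi>'\<close> and let bars mark the Frenet frame of \<open>\<beta>\<close> at the parameter \<open>\<psi> s\<close>.
  Differentiating \<open>\<beta> \<circ> \<psi> = \<alpha> + \<lambda> N\<close> with the Frenet equations of \<open>\<alpha>\<close> gives
  \<open>f T\<bar> = (1 - \<lambda> K) T + \<lambda> k B\<^sub>1\<close>
  (lemma \<open>offset_tangent\<close>). Since \<open>K\<close> and \<open>k\<close> do not vanish, the relation
  \<open>K = \<lambda> (K\<^sup>2 + k\<^sup>2)\<close> forces \<open>\<lambda> \<noteq> 0\<close>, so the \<open>B\<^sub>1\<close>-component on the right is nonzero and hence
  \<open>f \<noteq> 0\<close>. A function with nowhere vanishing derivative on an interval is injective by Rolle's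
  theorem, so \<open>\<psi>\<close> is an admissible correspondence of parameters.

  It remains to see that \<open>N\<close> is orthogonal to both \<open>T\<bar>\<close> and \<open>N\<bar>\<close>; it then lies in the plane of
  \<open>B\<^sub>1\<bar>\<close> and \<open>B\<^sub>2\<bar>\<close>, because the frame of \<open>\<beta>\<close> is an orthonormal basis of four-space. The first
  orthogonality is immediate from the displayed formula. For the second, differentiate
  \<open>\<langle>T\<bar>, N\<rangle> = 0\<close>: this yields \<open>f K\<bar> \<langle>N\<bar>, N\<rangle> + \<langle>T\<bar>, - K T + k B\<^sub>1\<rangle> = 0\<close>, and \<open>f\<close> times the last inner
  product is \<open>- K (1 - \<lambda> K) + \<lambda> k\<^sup>2 = \<lambda> (K\<^sup>2 + k\<^sup>2) - K\<close>, which vanishes exactly by the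
  hypothesis on the curvatures. Differentiating \<open>\<langle>T\<bar>, N\<rangle> = 0\<close> rather than the
  formula for \<open>f T\<bar>\<close> keeps the derivatives of \<open>f\<close>, \<open>K\<close> and \<open>k\<close> out of the computation.
\<close>

text \<open>
  Derivatives are taken within the parameter interval, end points included; they are
  determined by the function because an interval with two points has no isolated points.
\<close>

lemma has_vector_derivative_unique_on_interval:
  fixes f g :: "real \<Rightarrow> 'a::real_normed_vector"
  assumes I: "nondegenerate_interval I" and s: "s \<in> I"
    and f: "(f has_vector_derivative u) (at s within I)"
    and g: "(g has_vector_derivative v) (at s within I)"
    and eq: "\<And>t. t \<in> I \<Longrightarrow> f t = g t"
  shows "u = v"
proof -
  have "connected I" "\<And>x. I \<noteq> {x}"
    using I by (auto simp: nondegenerate_interval_def is_interval_connected)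
  then have "s islimpt I"
    using connected_imp_perfect[of I s] s by blast
  then have ne: "at s within I \<noteq> bot"
    by (simp add: trivial_limit_within)
  have "(f has_vector_derivative v) (at s within I)"
    using has_vector_derivative_transform[OF s eq g] by simp
  with ne f show ?thesis
    by (rule vector_derivative_unique_within)
qed

lemma inj_on_interval_if_derivative_nonzero:
  fixes \<psi> :: "real \<Rightarrow> real"
  assumes I: "is_interval I"
    and d: "\<And>s. s \<in> I \<Longrightarrow> (\<psi> has_real_derivative f s) (at s within I)"
    and nz: "\<And>s. s \<in> I \<Longrightarrow> f s \<noteq> 0"
  shows "inj_on \<psi> I"
proof (rule linorder_inj_onI)
  fix a b assume ab: "a < b" "a \<in> I" "b \<in> I"
  have sub: "{a..b} \<subseteq> I"
    using I ab unfolding is_interval_1 by (meson atLeastAtMost_iff subsetI)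
  show "\<psi> a \<noteq> \<psi> b"
  proof
    assume eq: "\<psi> a = \<psi> b"
    have "continuous_on {a..b} \<psi>"
      by (rule continuous_on_subset[OF DERIV_continuous_on[OF d] sub])
    moreover have "(\<psi> has_derivative (\<lambda>h. f x * h)) (at x)" if x: "a < x" "x < b" for x
    proof -
      have "(\<psi> has_real_derivative f x) (at x within {a<..<b})"
        using sub x by (intro DERIV_subset[OF d]) auto
      then have "(\<psi> has_real_derivative f x) (at x)"
        using x by (simp add: at_within_open[of x "{a<..<b}"])
      then show ?thesis
        by (simp add: has_field_derivative_def)
    qed
    ultimately obtain z where z: "a < z" "z < b" "(\<lambda>h. f z * h) = (\<lambda>h. 0)"
      using Rolle_deriv[OF ab(1) eq, of "\<lambda>x h. f x * h"] by blast
    from fun_cong[OF z(3), of 1] have "f z = 0" by simp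
    moreover have "z \<in> I" using subsetD[OF sub, of z] z by simp
    ultimately show False using nz by blast
  qed
qed auto

lemma smooth_on_const: "smooth_on I (\<lambda>_. c)"
  unfolding smooth_on_def
  by (rule exI[of _ "\<lambda>n _. if n = 0 then c else 0"]) simp

lemma smooth_on_imp_has_vector_derivative:
  assumes "smooth_on I f"
  obtains f' where "\<And>s. s \<in> I \<Longrightarrow> (f has_vector_derivative f' s) (at s within I)"
proof -
  obtain D where D: "\<And>s. s \<in> I \<Longrightarrow> D (0::nat) s = f s"
      "\<And>n s. s \<in> I \<Longrightarrow> (D n has_vector_derivative D (Suc n) s) (at s within I)"
    using assms unfolding smooth_on_def by blast
  have "(f has_vector_derivative D (Suc 0) s) (at s within I)" if "s \<in> I" for s
    using has_vector_derivative_transform[OF that _ D(2)[OF that, of 0], of f] D(1) by simp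
  then show ?thesis by (rule that)
qed

text \<open>
  Four orthonormal vectors are linearly independent and hence a basis of the four-dimensional
  space. So the difference between \<open>x\<close> and its projection onto the span of \<open>b\<close> and \<open>c\<close>, being
  orthogonal to all four, is zero.
\<close>

lemma h_orthonormal4_in_span:
  assumes on: "h_orthonormal4 t n b c" and xt: "x \<bullet> t = 0" and xn: "x \<bullet> n = 0"
  shows "x \<in> span {b, c}"
proof -
  note o = on[unfolded h_orthonormal4_def h_eq_inner]
  define S where "S = {t, n, b, c}"
  have ne: "t \<noteq> n" "t \<noteq> b" "t \<noteq> c" "n \<noteq> b" "n \<noteq> c" "b \<noteq> c"
    using o by auto
  have "0 \<notin> S" using o by (auto simp: S_def)
  moreover have "pairwise orthogonal S"
    using o by (auto simp: S_def pairwise_def orthogonal_def inner_commute)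
  ultimately have "independent S"
    using pairwise_orthogonal_independent by blast
  moreover have "card S = DIM(quat)"
    using ne by (simp add: S_def)
  ultimately have span: "span S = UNIV"
    by (metis card_eq_dim dim_UNIV independent_imp_finite subset_UNIV top.extremum_uniqueI)
  define y where "y = x - (x \<bullet> b) *\<^sub>R b - (x \<bullet> c) *\<^sub>R c"
  have "orthogonal y z" if "z \<in> S" for z
  proof -
    have "c \<bullet> b = 0" "b \<bullet> n = 0" "b \<bullet> t = 0" "c \<bullet> n = 0" "c \<bullet> t = 0"
      using o by (simp_all add: inner_commute)
    with that o xt xn show ?thesis
      by (auto simp: S_def y_def orthogonal_def inner_diff_left)
  qed
  then have "orthogonal y y"
    using span orthogonal_to_span by (metis UNIV_I)
  then have "(x \<bullet> b) *\<^sub>R b + (x \<bullet> c) *\<^sub>R c = x"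
    by (simp add: orthogonal_self y_def algebra_simps)
  moreover have "(x \<bullet> b) *\<^sub>R b + (x \<bullet> c) *\<^sub>R c \<in> span {b, c}"
    by (intro span_add span_scale span_base) auto
  ultimately show ?thesis by simp
qed

text \<open>
  Both sides are the velocity of the curve at distance \<open>\<lambda>\<close> from \<open>\<alpha>\<close> along \<open>N\<close>: the left one by
  the chain rule, the right one by the Frenet equations of \<open>\<alpha>\<close>.
\<close>

lemma offset_tangent:
  assumes A: "quaternionic_curve A" and B: "quaternionic_curve B"
    and im: "\<psi> ` cdom A = cdom B" and s: "s \<in> cdom A"
    and d: "(\<psi> has_vector_derivative f) (at s within cdom A)"
    and off: "\<And>s. s \<in> cdom A \<Longrightarrow> cpos B (\<psi> s) = cpos A s + lam *\<^sub>R cN A s"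
  shows "f *\<^sub>R cT B (\<psi> s) = (1 - lam * cK A s) *\<^sub>R cT A s + (lam * ck A s) *\<^sub>R cB1 A s"
proof -
  have \<psi>s: "\<psi> s \<in> cdom B" using s im by blast
  have "(cpos B has_vector_derivative cT B (\<psi> s)) (at (\<psi> s) within \<psi> ` cdom A)"
    using B \<psi>s im by (simp add: quaternionic_curve_def)
  then have L: "((cpos B \<circ> \<psi>) has_vector_derivative f *\<^sub>R cT B (\<psi> s)) (at s within cdom A)"
    by (rule vector_diff_chain_within[OF d])
  have dA: "(cpos A has_vector_derivative cT A s) (at s within cdom A)"
      "(cN A has_vector_derivative - cK A s *\<^sub>R cT A s + ck A s *\<^sub>R cB1 A s) (at s within cdom A)"
    using A s by (auto simp: quaternionic_curve_def)
  have "((\<lambda>s. cpos A s + lam *\<^sub>R cN A s) has_vector_derivative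
      cT A s + lam *\<^sub>R (- cK A s *\<^sub>R cT A s + ck A s *\<^sub>R cB1 A s)) (at s within cdom A)"
    by (intro has_vector_derivative_add dA
        bounded_linear.has_vector_derivative[OF bounded_linear_scaleR_right])
  from has_vector_derivative_unique_on_interval[OF _ s L this] A off
  show ?thesis
    by (simp add: quaternionic_curve_def algebra_simps)
qed

theorem theorem3p9:
  fixes A B :: curve4 and lam :: real and \<psi> :: "real \<Rightarrow> real"
  assumes "quaternionic_curve A"
    and "\<not> cK A constant_on cdom A"
    and "\<not> ck A constant_on cdom A"
    and "\<And>s. s \<in> cdom A \<Longrightarrow> cK A s = lam * ((cK A s)\<^sup>2 + (ck A s)\<^sup>2)"
    and "quaternionic_curve B"
    and "smooth_on (cdom A) \<psi>"
    and "\<psi> ` cdom A = cdom B"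
    and "\<And>s. s \<in> cdom A \<Longrightarrow> cpos B (\<psi> s) = cpos A s + lam *\<^sub>R cN A s"
  shows "quaternionic_mannheim_curve A \<and> mannheim_partner A B"
proof -
  note A = assms(1) and curv = assms(4) and B = assms(5) and im = assms(7) and off = assms(8)
  obtain f where f: "\<And>s. s \<in> cdom A \<Longrightarrow> (\<psi> has_vector_derivative f s) (at s within cdom A)"
    using smooth_on_imp_has_vector_derivative[OF assms(6)] by blast
  have I: "nondegenerate_interval (cdom A)"
    using A by (simp add: quaternionic_curve_def)
  have \<psi>_in: "\<psi> s \<in> cdom B" if "s \<in> cdom A" for s
    using that im by blast
  have oA: "cT A s \<bullet> cT A s = 1" "cB1 A s \<bullet> cB1 A s = 1" "cT A s \<bullet> cN A s = 0"
      "cT A s \<bullet> cB1 A s = 0" "cB1 A s \<bullet> cT A s = 0" "cB1 A s \<bullet> cN A s = 0"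
    if "s \<in> cdom A" for s
    using A that by (auto simp: quaternionic_curve_def h_orthonormal4_def h_eq_inner inner_commute)
  have tangent: "f s *\<^sub>R cT B (\<psi> s) =
      (1 - lam * cK A s) *\<^sub>R cT A s + (lam * ck A s) *\<^sub>R cB1 A s" if "s \<in> cdom A" for s
    using offset_tangent[OF A B im that f[OF that] off] .
  have TT: "f s * (cT B (\<psi> s) \<bullet> cT A s) = 1 - lam * cK A s"
    and TN: "f s * (cT B (\<psi> s) \<bullet> cN A s) = 0"
    and TB: "f s * (cT B (\<psi> s) \<bullet> cB1 A s) = lam * ck A s" if "s \<in> cdom A" for s
    using arg_cong[OF tangent[OF that], of "\<lambda>x. x \<bullet> cT A s"]
      arg_cong[OF tangent[OF that], of "\<lambda>x. x \<bullet> cN A s"]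
      arg_cong[OF tangent[OF that], of "\<lambda>x. x \<bullet> cB1 A s"] oA[OF that]
    by (simp_all add: inner_add_left)
  have nzA: "cK A s \<noteq> 0" "ck A s \<noteq> 0" if "s \<in> cdom A" for s
    using A that by (auto simp: quaternionic_curve_def)
  have f_nz: "f s \<noteq> 0" if "s \<in> cdom A" for s
  proof
    assume "f s = 0"
    with TB[OF that] nzA[OF that] have "lam = 0" by simp
    with curv[OF that] nzA[OF that] show False by simp
  qed
  have f_real: "(\<psi> has_real_derivative f s) (at s within cdom A)" if "s \<in> cdom A" for s
    using f[OF that] by (simp add: has_real_derivative_iff_has_vector_derivative)
  have \<psi>_inj: "inj_on \<psi> (cdom A)"
    using inj_on_interval_if_derivative_nonzero[OF _ f_real f_nz] I
    by (auto simp: nondegenerate_interval_def)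
  have TN0: "cT B (\<psi> s) \<bullet> cN A s = 0" if "s \<in> cdom A" for s
    using TN[OF that] f_nz[OF that] by simp
  have NN0: "cN B (\<psi> s) \<bullet> cN A s = 0" if s: "s \<in> cdom A" for s
  proof -
    let ?T = "cT B (\<psi> s)" and ?N' = "- cK A s *\<^sub>R cT A s + ck A s *\<^sub>R cB1 A s"
    have "(cT B has_vector_derivative cK B (\<psi> s) *\<^sub>R cN B (\<psi> s)) (at (\<psi> s) within \<psi> ` cdom A)"
      using B \<psi>_in[OF s] im by (simp add: quaternionic_curve_def)
    then have dT: "((cT B \<circ> \<psi>) has_vector_derivative f s *\<^sub>R cK B (\<psi> s) *\<^sub>R cN B (\<psi> s))
        (at s within cdom A)"
      by (rule vector_diff_chain_within[OF f[OF s]])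
    have dN: "(cN A has_vector_derivative ?N') (at s within cdom A)"
      using A s by (simp add: quaternionic_curve_def)
    have "((\<lambda>s. (cT B \<circ> \<psi>) s \<bullet> cN A s) has_vector_derivative
        (cT B \<circ> \<psi>) s \<bullet> ?N' + (f s *\<^sub>R cK B (\<psi> s) *\<^sub>R cN B (\<psi> s)) \<bullet> cN A s) (at s within cdom A)"
      by (rule bounded_bilinear.has_vector_derivative[OF bounded_bilinear_inner dT dN])
    from has_vector_derivative_unique_on_interval[OF I s this has_vector_derivative_const[of 0]]
    have sum0: "?T \<bullet> ?N' + f s * cK B (\<psi> s) * (cN B (\<psi> s) \<bullet> cN A s) = 0"
      using TN0 by simp
    have "f s * (?T \<bullet> ?N') = - cK A s * (f s * (?T \<bullet> cT A s)) + ck A s * (f s * (?T \<bullet> cB1 A s))"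
      by (simp add: inner_add_right algebra_simps)
    also have "\<dots> = lam * ((cK A s)\<^sup>2 + (ck A s)\<^sup>2) - cK A s"
      unfolding TT[OF s] TB[OF s] by (simp add: algebra_simps power2_eq_square)
    also have "\<dots> = 0"
      using curv[OF s] by simp
    finally have "?T \<bullet> ?N' = 0"
      using f_nz[OF s] by simp
    moreover have "cK B (\<psi> s) \<noteq> 0"
      using B \<psi>_in[OF s] by (simp add: quaternionic_curve_def)
    ultimately show ?thesis
      using sum0 f_nz[OF s] by simp
  qed
  have plane: "cN A s \<in> span {cB1 B (\<psi> s), cB2 B (\<psi> s)}" if s: "s \<in> cdom A" for s
  proof (rule h_orthonormal4_in_span)
    show "h_orthonormal4 (cT B (\<psi> s)) (cN B (\<psi> s)) (cB1 B (\<psi> s)) (cB2 B (\<psi> s))"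
      using B \<psi>_in[OF s] by (simp add: quaternionic_curve_def)
  qed (use TN0[OF s] NN0[OF s] in \<open>simp_all add: inner_commute\<close>)
  have \<psi>_bij: "bij_betw \<psi> (cdom A) (cdom B)"
    using \<psi>_inj im by (simp add: bij_betw_def)
  define \<phi> where "\<phi> = (\<lambda>p :: real \<times> quat. (\<psi> (fst p), cpos B (\<psi> (fst p))))"
  have "bij_betw \<phi> (curve_points A) (curve_points B)"
    unfolding bij_betw_def
  proof
    show "inj_on \<phi> (curve_points A)"
      using \<psi>_inj by (auto simp: inj_on_def curve_points_def \<phi>_def)
    show "\<phi> ` curve_points A = curve_points B"
      unfolding curve_points_def im[symmetric] by (simp add: image_image \<phi>_def)
  qed
  moreover have "\<forall>s\<in>cdom A. \<phi> (s, cpos A s) = (\<psi> s, cpos B (\<psi> s))"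
    by (simp add: \<phi>_def)
  moreover have "\<forall>s\<in>cdom A. \<exists>d. (\<psi> has_real_derivative d) (at s within cdom A) \<and> d \<noteq> 0"
    using f_real f_nz by blast
  ultimately have "mannheim_partner A B"
    unfolding mannheim_partner_def
    using A B \<psi>_bij assms(6) smooth_on_const[of "cdom A" lam] plane off
    by (intro conjI exI[of _ \<phi>] exI[of _ \<psi>] exI[of _ "\<lambda>_. lam"]) auto
  then show ?thesis
    using A by (auto simp: quaternionic_mannheim_curve_def)
qed

end
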